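(* Let $R\in\mathbb{R}^{n\times n}$ be invertible and let $x:\,]a,b[\,\to\mathbb{R}^n$ be differentiable. Then for all $t\in\,]a,b[$, (i) $D^+\|x(t)\|_{\infty,R}=\max_{i\in I_\infty(Rx(t))}\operatorname{sign}((Rx(t))_i)(R\dot x(t))_i+\chi_{\{0_n\}}(Rx(t))\,\|\dot x(t)\|_{\infty,R}$, and (ii) $\|x(t)\|_{\infty,R}\,D^+\|x(t)\|_{\infty,R}=[\![\dot x(t),x(t)]\!]_{\infty,R}$.
   Context: $\|x\|_{\infty,R}=\|Rx\|_\infty$; $I_\infty(v)=\{j\in\{1,\dots,n\}:|v_j|=\|v\|_\infty\}$; the max pairing is $[\![x,y]\!]_{\infty,R}=\max_{i\in I_\infty(Ry)}(Rx)_i(Ry)_i$. $\operatorname{sign}(0)=0$. $\chi_A(x)$ equals $1$ if $x\in A$ and $0$ otherwise. $0_n$ is the zero vector. $D^+\varphi(t)=\limsup_{h\to0^+}\frac{\varphi(t+h)-\varphi(t)}{h}$ is the upper right Dini derivative. *)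

theory Defs
  imports "HOL-Analysis.Analysis"
begin

definition weighted_infnorm :: "real ^ 'n ^ 'n \<Rightarrow> real ^ 'n \<Rightarrow> real" where
  "weighted_infnorm R x = infnorm (R *v x)"

definition I_inf :: "real ^ 'n \<Rightarrow> 'n set" where
  "I_inf v = {j. \<bar>v $ j\<bar> = infnorm v}"

definition max_pairing :: "real ^ 'n ^ 'n \<Rightarrow> real ^ 'n \<Rightarrow> real ^ 'n \<Rightarrow> real" where
  "max_pairing R x y = Max ((\<lambda>i. (R *v x) $ i * (R *v y) $ i) ` I_inf (R *v y))"

text \<open>
  The limit superior is taken in the extended reals, so that it exists for every function;
  finiteness of the derivative is a claim and not built into the definition.
\<close>

definition upper_right_Dini :: "(real \<Rightarrow> real) \<Rightarrow> real \<Rightarrow> ereal" where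
  "upper_right_Dini \<phi> t = Limsup (at_right 0) (\<lambda>h. ereal ((\<phi> (t + h) - \<phi> t) / h))"

text \<open>
  The index set is nonempty and finite, so that \<^term>\<open>Max\<close> above is a genuine maximum.
\<close>

lemma finite_I_inf: "finite (I_inf v)"
  by simp

lemma I_inf_nonempty: "I_inf v \<noteq> {}"
proof -
  have eq: "{\<bar>v \<bullet> b\<bar> | b. b \<in> Basis} = range (\<lambda>i. \<bar>v $ i\<bar>)"
    by (auto simp: Basis_vec_def inner_axis image_iff) (metis inner_axis inner_real_def mult.right_neutral)
  have "infnorm v = Max (range (\<lambda>i. \<bar>v $ i\<bar>))"
    unfolding infnorm_def eq by (rule cSup_eq_Max) auto
  also have "\<dots> \<in> range (\<lambda>i. \<bar>v $ i\<bar>)"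
    by (rule Max_in) auto
  finally show ?thesis
    by (auto simp: I_inf_def)
qed

end

theory Submission
  imports Defs
begin

text \<open>
  Along a ray the \<open>\<infinity>\<close>-norm is piecewise affine, so its right derivative there is not
  merely a limit: for all small \<open>h > 0\<close> the increment from \<open>v\<close> to \<open>v + h w\<close> equals \<open>h\<close> times
  a slope.  For \<open>v \<noteq> 0\<close>, the coordinates of largest modulus are nonzero, keep their signs and
  so move affinely with slopes \<open>sign(v\<^sub>i) w\<^sub>i\<close>, while the others start strictly below and
  cannot catch up immediately; the largest of these slopes wins.  For \<open>v = 0\<close> all the signs vanish
  and homogeneity gives the slope \<open>\<parallel>w\<parallel>\<close>, which is what the indicator term supplies
  (\<open>eventually_infnorm_ray\<close>).

  A differentiable curve stays within \<open>o(h)\<close> of its tangent ray, and the norm is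
  Lipschitz, so the difference quotients along the curve converge to the same slope
  (\<open>tendsto_infnorm_difference_quotient\<close>).  This settles the upper limit in (i), with the curve
  \<open>R x\<close> and its velocity \<open>R x'\<close>.  Identity (ii) is then algebra: on \<open>I_inf v\<close> one has
  \<open>v\<^sub>i = \<parallel>v\<parallel> sign(v\<^sub>i)\<close>, and the indicator term is annihilated by the factor \<open>\<parallel>v\<parallel>\<close>.
\<close>

definition infnorm_slope :: "real ^ 'n \<Rightarrow> real ^ 'n \<Rightarrow> real" where
  "infnorm_slope v w =
     Max ((\<lambda>i. sgn (v $ i) * w $ i) ` I_inf v) + indicator {0} v * infnorm w"

lemma infnorm_eq_iff_cart:
  fixes v :: "real ^ 'n"
  shows "infnorm v = c \<longleftrightarrow> (\<forall>i. \<bar>v $ i\<bar> \<le> c) \<and> (\<exists>i. \<bar>v $ i\<bar> = c)"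
proof -
  obtain j where "\<bar>v $ j\<bar> = infnorm v"
    using I_inf_nonempty[of v] by (auto simp: I_inf_def)
  then show ?thesis
    by (metis component_le_infnorm_cart order_antisym)
qed

lemma infnorm_slope_zero:
  fixes w :: "real ^ 'n"
  shows "infnorm_slope 0 w = infnorm w"
proof -
  have "(\<lambda>i. sgn ((0 :: real ^ 'n) $ i) * w $ i) ` I_inf 0 = {0}"
    using I_inf_nonempty[of "0 :: real ^ 'n"] by auto
  then show ?thesis
    by (simp add: infnorm_slope_def)
qed

text \<open>
  The slope describes the norm exactly, without remainder term, because only finitely many
  coordinates have to keep their signs and their ranks.
\<close>

lemma eventually_infnorm_ray:
  fixes v w :: "real ^ 'n"
  shows "\<forall>\<^sub>F h in at_right 0. infnorm (v + h *\<^sub>R w) = infnorm v + h * infnorm_slope v w"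
proof (cases "v = 0")
  case True
  show ?thesis
    using eventually_at_right_less[of 0]
    by eventually_elim (simp add: True infnorm_slope_zero infnorm_mul infnorm_0)
next
  case False
  let ?s = "\<lambda>i. sgn (v $ i) * w $ i"
  define m where "m = Max (?s ` I_inf v)"
  have slope: "infnorm_slope v w = m"
    using False by (simp add: infnorm_slope_def m_def)
  have m_ge: "?s i \<le> m" if "i \<in> I_inf v" for i
    unfolding m_def using that by (intro Max_ge) auto
  have "m \<in> ?s ` I_inf v"
    unfolding m_def by (rule Max_in) (use I_inf_nonempty[of v] in auto)
  then obtain k where k: "k \<in> I_inf v" "?s k = m"
    by blast
  have active: "\<forall>\<^sub>F h in at_right 0. \<bar>(v + h *\<^sub>R w) $ i\<bar> = infnorm v + h * ?s i"
    if "i \<in> I_inf v" for i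
  proof -
    have norm_i: "\<bar>v $ i\<bar> = infnorm v"
      using that by (simp add: I_inf_def)
    \<comment> \<open>Multiplying by the initial sign makes the coordinate positive, and it remains so.\<close>
    have signed: "sgn (v $ i) * (v + h *\<^sub>R w) $ i = infnorm v + h * ?s i" for h
      using norm_i by (simp add: distrib_left abs_sgn mult_ac)
    have unit: "\<bar>sgn (v $ i)\<bar> = 1"
      using norm_i False by (auto simp: sgn_if infnorm_eq_0)
    have "((\<lambda>h. infnorm v + h * ?s i) \<longlongrightarrow> infnorm v + 0 * ?s i) (at_right 0)"
      by (intro tendsto_intros)
    then have "\<forall>\<^sub>F h in at_right 0. 0 < infnorm v + h * ?s i"
      by (rule order_tendstoD) (use False in \<open>simp add: infnorm_pos_lt\<close>)
    then show ?thesis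
    proof eventually_elim
      case (elim h)
      have "\<bar>(v + h *\<^sub>R w) $ i\<bar> = \<bar>sgn (v $ i) * (v + h *\<^sub>R w) $ i\<bar>"
        unfolding abs_mult unit by simp
      then show ?case
        unfolding signed using elim by simp
    qed
  qed
  have "\<forall>\<^sub>F h in at_right 0. \<bar>(v + h *\<^sub>R w) $ i\<bar> \<le> infnorm v + h * m" for i
  proof (cases "i \<in> I_inf v")
    case True
    show ?thesis
      using active[OF True] eventually_at_right_less[of 0]
      by eventually_elim (use m_ge[OF True] in \<open>simp add: mult_left_mono\<close>)
  next
    case False
    have "((\<lambda>h. \<bar>(v + h *\<^sub>R w) $ i\<bar> - h * m) \<longlongrightarrow> \<bar>(v + 0 *\<^sub>R w) $ i\<bar> - 0 * m) (at_right 0)"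
      by (intro tendsto_intros)
    moreover have "\<bar>v $ i\<bar> < infnorm v"
      using False component_le_infnorm_cart[of v i] by (simp add: I_inf_def)
    ultimately have "\<forall>\<^sub>F h in at_right 0. \<bar>(v + h *\<^sub>R w) $ i\<bar> - h * m < infnorm v"
      by (intro order_tendstoD) auto
    then show ?thesis
      by eventually_elim simp
  qed
  then have "\<forall>\<^sub>F h in at_right 0. \<forall>i. \<bar>(v + h *\<^sub>R w) $ i\<bar> \<le> infnorm v + h * m"
    by (rule eventually_all_finite)
  then show ?thesis
    using active[OF k(1)]
  proof eventually_elim
    case (elim h)
    have "\<exists>i. \<bar>(v + h *\<^sub>R w) $ i\<bar> = infnorm v + h * m"
      using elim(2) unfolding k(2) by (rule exI)
    with elim(1) show ?case
      unfolding slope by (simp only: infnorm_eq_iff_cart simp_thms)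
  qed
qed

text \<open>
  Since \<^const>\<open>infnorm\<close> is Lipschitz with constant one for the Euclidean norm, replacing the curve
  by its tangent ray changes the quotient by at most the remainder over \<open>h\<close>, which tends to
  zero; on the ray the quotient is eventually constant.
\<close>

lemma tendsto_infnorm_difference_quotient:
  fixes y :: "real \<Rightarrow> real ^ 'n"
  assumes "(y has_vector_derivative w) (at t)"
  shows "((\<lambda>h. (infnorm (y (t + h)) - infnorm (y t)) / h) \<longlongrightarrow> infnorm_slope (y t) w)
           (at_right 0)"
proof (rule Lim_transform)
  let ?r = "\<lambda>h. y (t + h) - y t - h *\<^sub>R w"
  have "((\<lambda>h. norm (?r h) / norm h) \<longlongrightarrow> 0) (at 0)"
    using assms by (simp add: has_vector_derivative_def has_derivative_at)
  then have rem: "((\<lambda>h. norm (?r h) / norm h) \<longlongrightarrow> 0) (at_right 0)"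
    by (rule tendsto_within_subset) simp
  show "((\<lambda>h. (infnorm (y t + h *\<^sub>R w) - infnorm (y t)) / h) \<longlongrightarrow> infnorm_slope (y t) w)
          (at_right 0)"
  proof (rule tendsto_eventually)
    show "\<forall>\<^sub>F h in at_right 0. (infnorm (y t + h *\<^sub>R w) - infnorm (y t)) / h = infnorm_slope (y t) w"
      using eventually_infnorm_ray[of "y t" w] eventually_at_right_less[of 0]
      by eventually_elim simp
  qed
  show "((\<lambda>h. (infnorm (y (t + h)) - infnorm (y t)) / h
              - (infnorm (y t + h *\<^sub>R w) - infnorm (y t)) / h) \<longlongrightarrow> 0) (at_right 0)"
  proof (rule Lim_null_comparison[OF always_eventually rem], rule allI)
    fix h :: real
    have "\<bar>infnorm (y (t + h)) - infnorm (y t + h *\<^sub>R w)\<bar> \<le> infnorm (?r h)"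
      using absdiff_infnorm[of "y (t + h)" "y t + h *\<^sub>R w"]
      by (simp add: diff_diff_eq)
    also have "\<dots> \<le> norm (?r h)"
      by (rule infnorm_le_norm)
    finally show "norm ((infnorm (y (t + h)) - infnorm (y t)) / h
                        - (infnorm (y t + h *\<^sub>R w) - infnorm (y t)) / h) \<le> norm (?r h) / norm h"
      by (simp flip: diff_divide_distrib add: divide_right_mono)
  qed
qed

text \<open>
  Multiplication by the norm turns the signs of the maximal coordinates back into the coordinates,
  so that no case distinction on \<open>v = 0\<close> survives; being monotone, it commutes with the maximum.
\<close>

lemma infnorm_times_infnorm_slope:
  "infnorm v * infnorm_slope v w = Max ((\<lambda>i. w $ i * v $ i) ` I_inf v)"
proof -
  have "mono ((*) (infnorm v))"
    by (intro monoI mult_left_mono infnorm_pos_le)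
  then have "infnorm v * Max ((\<lambda>i. sgn (v $ i) * w $ i) ` I_inf v)
      = Max ((*) (infnorm v) ` (\<lambda>i. sgn (v $ i) * w $ i) ` I_inf v)"
    by (intro mono_Max_commute) (use I_inf_nonempty in auto)
  also have "(*) (infnorm v) ` (\<lambda>i. sgn (v $ i) * w $ i) ` I_inf v = (\<lambda>i. w $ i * v $ i) ` I_inf v"
    unfolding image_image
    by (intro image_cong refl) (auto simp: I_inf_def sgn_if abs_if split: if_splits)
  finally show ?thesis
    by (simp add: infnorm_slope_def distrib_left indicator_def infnorm_0)
qed

theorem theorem25:
  fixes R :: "real ^ 'n ^ 'n" and x :: "real \<Rightarrow> real ^ 'n" and a b :: real
  assumes "invertible R"
    and "x differentiable_on {a<..<b}"
  shows "\<forall>t\<in>{a<..<b}.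
    upper_right_Dini (\<lambda>s. weighted_infnorm R (x s)) t =
      ereal (Max ((\<lambda>i. sgn ((R *v x t) $ i) * (R *v vector_derivative x (at t)) $ i)
                    ` I_inf (R *v x t))
             + indicator {0} (R *v x t) * weighted_infnorm R (vector_derivative x (at t)))
    \<and> ereal (weighted_infnorm R (x t)) * upper_right_Dini (\<lambda>s. weighted_infnorm R (x s)) t =
      ereal (max_pairing R (vector_derivative x (at t)) (x t))"
proof (intro ballI)
  fix t assume t: "t \<in> {a<..<b}"
  let ?v = "R *v x t" and ?w = "R *v vector_derivative x (at t)"
  have "x differentiable (at t)"
    using assms(2) t by (simp add: differentiable_on_eq_differentiable_at)
  then have "((\<lambda>s. R *v x s) has_vector_derivative ?w) (at t)"
    unfolding vector_derivative_works
    by (rule bounded_linear.has_vector_derivative[OF matrix_vector_mul_bounded_linear])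
  from tendsto_infnorm_difference_quotient[OF this]
  have "upper_right_Dini (\<lambda>s. weighted_infnorm R (x s)) t = ereal (infnorm_slope ?v ?w)"
    unfolding upper_right_Dini_def weighted_infnorm_def
    by (intro lim_imp_Limsup) auto
  then show "upper_right_Dini (\<lambda>s. weighted_infnorm R (x s)) t =
      ereal (Max ((\<lambda>i. sgn ((R *v x t) $ i) * (R *v vector_derivative x (at t)) $ i)
                    ` I_inf (R *v x t))
             + indicator {0} (R *v x t) * weighted_infnorm R (vector_derivative x (at t)))
    \<and> ereal (weighted_infnorm R (x t)) * upper_right_Dini (\<lambda>s. weighted_infnorm R (x s)) t =
      ereal (max_pairing R (vector_derivative x (at t)) (x t))"
    using infnorm_times_infnorm_slope[of ?v ?w]
    by (simp add: infnorm_slope_def weighted_infnorm_def max_pairing_def)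
qed

end
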